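(* Let $\bar\lambda=\langle\lambda_i: i<\kappa\rangle$ be a sequence of infinite regular cardinals, $I^*$ an ideal on $\kappa$ and $\theta$ a cardinal such that at least one of the following holds: ($\alpha$) $\min_{i<\kappa}\lambda_i>\theta\ge \mathrm{wsat}(I^* )$; or ($\beta$) $\liminf_{I^*}(\bar\lambda)\ge\theta\ge\mathrm{wsat}(I^* )$ and $(\prod\bar\lambda,\le_{I^*})$ is $\theta^+$-directed. Then $\mathrm{pcf}(\bar\lambda)$ has a last (maximal) element.
   Context: $\kappa$ is an infinite cardinal; $I^*$ is a proper ideal on $\kappa$; $\prod\bar\lambda=\prod_{i<\kappa}\lambda_i$. For an ideal $J$, $f\le_J g$ means $\{i<\kappa:\neg f(i)\le g(i)\}\in J$; for a filter $D$ the order on $\prod\bar\lambda/D$ is taken modulo the dual ideal. $I^+=\mathcal P(\kappa)\setminus I$. A (quasi-)partial order $P$ is $\lambda$-directed if every $A\subseteq P$ with $|A|<\lambda$ has an upper bound in $P$. $\mathrm{tcf}(P)$ is the least $\lambda$ such that there is a strictly increasing sequence $\langle p_\alpha:\alpha<\lambda\rangle$ in $P$ with every $q\in P$ below some $p_\alpha$ (well defined for $\prod\bar\lambda/D$, $D$ an ultrafilter). $\liminf_{I}(\bar\lambda)=\min\{\mu:\{i<\kappa:\lambda_i\le\mu\}\in I^+\}$. $\mathrm{wsat}(I)$ is the least cardinal $\theta$ such that $\kappa$ cannot be partitioned into $\theta$ pairwise disjoint sets each in $I^+$. $\mathrm{pcf}(\bar\lambda)=\{\mathrm{tcf}(\prod\bar\lambda/D):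 D$ an ultrafilter on $\kappa$ with $D\cap I^*=\emptyset\}$. *)

theory Defs
  imports Main "HOL-Library.FuncSet" "HOL-Library.Disjoint_Sets"
begin

unbundle cardinal_syntax

(* Cardinals are the library's cardinal orders (Card_order), compared up to order
   isomorphism (=o, <=o, <o). A cardinal kappa is used as the index set Field kappa, and
   the ordinals below a cardinal lam i are the elements of Field (lam i), ordered by lam i. *)

(* Card_order relations are only unique up to =o, hence the choice of one representative.
   Meaningful for a nonempty set of cardinals only. *)
definition min_card :: "'a rel set \<Rightarrow> 'a rel" where
  "min_card R = (SOME r. r \<in> R \<and> (\<forall>s\<in>R. r \<le>o s))"

definition proper_ideal_on :: "'i set \<Rightarrow> 'i set set \<Rightarrow> bool" where
  "proper_ideal_on K I \<longleftrightarrow>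
     I \<subseteq> Pow K \<and> {} \<in> I \<and> (\<forall>A\<in>I. \<forall>B\<subseteq>A. B \<in> I) \<and> (\<forall>A\<in>I. \<forall>B\<in>I. A \<union> B \<in> I) \<and> K \<notin> I"

definition ultrafilter_on :: "'i set \<Rightarrow> 'i set set \<Rightarrow> bool" where
  "ultrafilter_on K D \<longleftrightarrow>
     D \<subseteq> Pow K \<and> K \<in> D \<and> {} \<notin> D \<and>
     (\<forall>A\<in>D. \<forall>B\<in>D. A \<inter> B \<in> D) \<and> (\<forall>A\<in>D. \<forall>B. A \<subseteq> B \<and> B \<subseteq> K \<longrightarrow> B \<in> D) \<and>
     (\<forall>A\<subseteq>K. A \<in> D \<or> K - A \<in> D)"

definition dual_ideal :: "'i set \<Rightarrow> 'i set set \<Rightarrow> 'i set set" where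
  "dual_ideal K D = (\<lambda>A. K - A) ` D"

definition positive_sets :: "'i set \<Rightarrow> 'i set set \<Rightarrow> 'i set set" where
  "positive_sets K I = Pow K - I"

definition card_prod :: "'i set \<Rightarrow> ('i \<Rightarrow> 'a rel) \<Rightarrow> ('i \<Rightarrow> 'a) set" where
  "card_prod K lam = (\<Pi>\<^sub>E i\<in>K. Field (lam i))"

definition le_mod :: "'i set \<Rightarrow> ('i \<Rightarrow> 'a rel) \<Rightarrow> 'i set set \<Rightarrow> ('i \<Rightarrow> 'a) \<Rightarrow> ('i \<Rightarrow> 'a) \<Rightarrow> bool" where
  "le_mod K lam J f g \<longleftrightarrow> {i \<in> K. (f i, g i) \<notin> lam i} \<in> J"

definition directed :: "'c rel \<Rightarrow> 'p set \<Rightarrow> ('p \<Rightarrow> 'p \<Rightarrow> bool) \<Rightarrow> bool" where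
  "directed \<mu> P le \<longleftrightarrow> (\<forall>A\<subseteq>P. |A| <o \<mu> \<longrightarrow> (\<exists>u\<in>P. \<forall>a\<in>A. le a u))"

(* le is a quasi-order on P; its strict part is "le x y and not le y x". *)
definition has_scale :: "'p set \<Rightarrow> ('p \<Rightarrow> 'p \<Rightarrow> bool) \<Rightarrow> 'c rel \<Rightarrow> bool" where
  "has_scale P le \<mu> \<longleftrightarrow>
     (\<exists>p. (\<forall>a\<in>Field \<mu>. p a \<in> P) \<and>
          (\<forall>a b. (a, b) \<in> \<mu> \<and> a \<noteq> b \<longrightarrow> le (p a) (p b) \<and> \<not> le (p b) (p a)) \<and>
          (\<forall>q\<in>P. \<exists>a\<in>Field \<mu>. le q (p a)))"

(* A strictly increasing sequence in P is injective, so all candidate cardinals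
   are represented on the type of the elements of P. *)
definition tcf :: "'p set \<Rightarrow> ('p \<Rightarrow> 'p \<Rightarrow> bool) \<Rightarrow> 'p rel" where
  "tcf P le = min_card {\<mu>. Card_order \<mu> \<and> has_scale P le \<mu>}"

(* If I is proper, the cardinality of 'a is a candidate, so minimizing over the
   cardinals on 'a is minimizing over all cardinals. *)
definition liminf_mod :: "'i set \<Rightarrow> 'i set set \<Rightarrow> ('i \<Rightarrow> 'a rel) \<Rightarrow> 'a rel" where
  "liminf_mod K I lam =
     min_card {\<mu>. Card_order \<mu> \<and> {i \<in> K. lam i \<le>o \<mu>} \<in> positive_sets K I}"

(* The cardinal 0 is excluded: a nonempty K trivially has no partition into 0 sets.
   The value may be the successor of |K|, hence a cardinal on 'i set. *)
definition wsat :: "'i set \<Rightarrow> 'i set set \<Rightarrow> 'i set rel" where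
  "wsat K I =
     min_card {\<theta>. Card_order \<theta> \<and> Field \<theta> \<noteq> {} \<and>
       \<not> (\<exists>Q. partition_on K Q \<and> Q \<subseteq> positive_sets K I \<and> |Q| =o \<theta>)}"

definition pcf :: "'i set \<Rightarrow> 'i set set \<Rightarrow> ('i \<Rightarrow> 'a rel) \<Rightarrow> ('i \<Rightarrow> 'a) rel set" where
  "pcf K I lam =
     {tcf (card_prod K lam) (le_mod K lam (dual_ideal K D)) | D. ultrafilter_on K D \<and> D \<inter> I = {}}"

end

theory Submission
  imports Defs
begin

text \<open>
  Write \<open>tcf D\<close> for the true cofinality of the product modulo an ultrafilter \<open>D\<close> disjoint from the
  ideal \<open>I\<close>. As the product is linearly quasi-ordered modulo \<open>D\<close>, \<open>tcf D\<close> is simply the least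
  cardinality of a cofinal set: there is a cofinal set of that size, and every smaller set is
  bounded (\<open>ult_tcf\<close>).

  Suppose that pcf has no largest element. Call a set small if, for some \<open>D0\<close>, every ultrafilter
  \<open>D\<close> containing it satisfies \<open>tcf D < tcf D0\<close>. The small sets form a proper ideal that contains
  \<open>I\<close>, so some ultrafilter \<open>D\<close> contains no small set. Choose \<open>D'\<close> with \<open>tcf D < tcf D'\<close> and a
  family cofinal modulo \<open>D\<close> of size \<open>tcf D\<close>. This family is bounded modulo every \<open>E\<close> with
  \<open>tcf E \<ge> tcf D'\<close>, each time by a bound depending on \<open>E\<close>. If one bound \<open>g\<close> serves for all these
  \<open>E\<close> simultaneously, then the sets on which \<open>g\<close> fails to dominate members of the family are
  small, so \<open>g\<close> is also a bound modulo \<open>D\<close>, and hence a maximum modulo \<open>D\<close>. But a product of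
  limit ordinals has no maximum.

  The substance is therefore the passage from separate to simultaneous bounds (\<open>uniform_bound\<close>),
  which amounts to Shelah's theorem that the product is \<open>\<lambda>\<close>-directed modulo the ideal
  \<open>J_{<\<lambda>}\<close>. By induction on the size of the family one may replace it by an increasing one.
  If no common bound exists, candidates \<open>g a\<close> are built by recursion along the cardinal
  \<open>w = wsat I\<close>. Each \<open>g a\<close> fails modulo some ultrafilter, which supplies a correction \<open>H (g a)\<close>
  bounding the whole family there, and later candidates dominate all earlier corrections. A single
  member \<open>f\<close> of the family witnesses all these failures, and the sets where \<open>f\<close> lies above \<open>g a\<close>
  but below \<open>H (g a)\<close> are positive and pairwise disjoint, which contradicts the choice of \<open>w\<close>.

  Both alternatives of the hypothesis are used only through two consequences: fewer than \<open>w\<close>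
  functions can be dominated pointwise off a set in \<open>I\<close> that depends only on how many there are,
  and any \<open>w\<close> functions have a common bound modulo \<open>I\<close>.
\<close>

section \<open>Well-orders and cardinals\<close>

text \<open>Transfinite recursion in the form in which it is used below: the value at \<open>a\<close> has to lie in
  \<open>A a\<close> and to be related to every earlier value, and such a value always exists.\<close>

lemma transfinite_choice:
  assumes w: "Well_order w"
    and step: "\<And>a p. a \<in> Field w \<Longrightarrow> (\<And>b. b \<in> underS w a \<Longrightarrow> p b \<in> A b) \<Longrightarrow>
      \<exists>y\<in>A a. \<forall>b\<in>underS w a. R b (p b) a y"
  shows "\<exists>p. \<forall>a\<in>Field w. p a \<in> A a \<and> (\<forall>b\<in>underS w a. R b (p b) a (p a))"
proof -
  have "\<exists>p. \<forall>a. a \<in> Field w \<longrightarrow> p a \<in> A a \<and> (\<forall>b\<in>underS w a. R b (p b) a (p a))"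
  proof (rule dependent_wf_choice)
    show "wf (w - Id)"
      using w by (simp add: well_order_on_def)
  next
    fix p q :: "'a \<Rightarrow> 'b" and a y
    assume "\<And>b. (b, a) \<in> w - Id \<Longrightarrow> p b = q b"
    then have "p b = q b" if "b \<in> underS w a" for b
      using that by (auto simp: underS_def)
    then show "(a \<in> Field w \<longrightarrow> y \<in> A a \<and> (\<forall>b\<in>underS w a. R b (p b) a y)) \<longleftrightarrow>
        (a \<in> Field w \<longrightarrow> y \<in> A a \<and> (\<forall>b\<in>underS w a. R b (q b) a y))"
      by simp
  next
    fix a and p :: "'a \<Rightarrow> 'b"
    assume "\<And>b. (b, a) \<in> w - Id \<Longrightarrow>
      b \<in> Field w \<longrightarrow> p b \<in> A b \<and> (\<forall>c\<in>underS w b. R c (p c) b (p b))"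
    then have "p b \<in> A b" if "b \<in> underS w a" for b
      using that by (auto simp: underS_def Field_def)
    then show "\<exists>y. a \<in> Field w \<longrightarrow> y \<in> A a \<and> (\<forall>b\<in>underS w a. R b (p b) a y)"
      using step[of a p] by blast
  qed
  then show ?thesis
    by blast
qed

text \<open>Cardinals are well-ordered, so the choice in \<^const>\<open>min_card\<close> succeeds on every nonempty set
  of cardinals.\<close>

lemma min_card:
  assumes "R \<noteq> {}" and "\<And>r. r \<in> R \<Longrightarrow> Card_order r"
  shows "min_card R \<in> R" and "\<And>s. s \<in> R \<Longrightarrow> min_card R \<le>o s"
proof -
  have "\<exists>r. r \<in> R \<and> (\<forall>s\<in>R. r \<le>o s)"
    using exists_minim_Card_order[of R] assms by blast
  from someI_ex[OF this] show "min_card R \<in> R" and "\<And>s. s \<in> R \<Longrightarrow> min_card R \<le>o s"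
    by (auto simp: min_card_def)
qed

lemma Card_order_refl: "Card_order r \<Longrightarrow> a \<in> Field r \<Longrightarrow> (a, a) \<in> r"
  unfolding card_order_on_def well_order_on_def linear_order_on_def partial_order_on_def
    preorder_on_def by (auto simp: refl_on_def)

lemma Card_order_trans: "Card_order r \<Longrightarrow> (a, b) \<in> r \<Longrightarrow> (b, c) \<in> r \<Longrightarrow> (a, c) \<in> r"
  unfolding card_order_on_def well_order_on_def linear_order_on_def partial_order_on_def
    preorder_on_def by (meson transD)

lemma Card_order_total:
  "Card_order r \<Longrightarrow> a \<in> Field r \<Longrightarrow> b \<in> Field r \<Longrightarrow> (a, b) \<in> r \<or> (b, a) \<in> r"
  by (metis Card_order_refl card_order_on_def linear_order_on_def total_on_def well_order_on_def)

lemma Card_order_antisym: "Card_order r \<Longrightarrow> (a, b) \<in> r \<Longrightarrow> (b, a) \<in> r \<Longrightarrow> a = b"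
  unfolding card_order_on_def well_order_on_def linear_order_on_def partial_order_on_def
  by (auto dest: antisymD)

lemma Card_order_underS_total:
  "Card_order r \<Longrightarrow> a \<in> Field r \<Longrightarrow> b \<in> Field r \<Longrightarrow> a \<noteq> b \<Longrightarrow> a \<in> underS r b \<or> b \<in> underS r a"
  using Card_order_total[of r a b] by (auto simp: underS_def)

lemma regularCard_bounded:
  assumes r: "Card_order r" "regularCard r" and X: "X \<subseteq> Field r" "|X| <o r"
  shows "\<exists>a\<in>Field r. \<forall>b\<in>X. (b, a) \<in> r"
proof -
  have "\<not> cofinal X r"
    using assms not_ordLess_ordIso[of "|X|" r] by (auto simp: regularCard_def)
  then obtain a where "a \<in> Field r" "\<And>b. b \<in> X \<Longrightarrow> a = b \<or> (a, b) \<notin> r"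
    by (auto simp: cofinal_def)
  then show ?thesis
    using Card_order_total[OF r(1)] Card_order_refl[OF r(1)] X(1) by (metis subsetD)
qed

section \<open>Ideals and ultrafilters\<close>

lemma proper_ideal_onD:
  assumes "proper_ideal_on K I"
  shows "A \<in> I \<Longrightarrow> A \<subseteq> K" and "{} \<in> I" and "A \<in> I \<Longrightarrow> B \<subseteq> A \<Longrightarrow> B \<in> I"
  using assms by (auto simp: proper_ideal_on_def)

text \<open>The boolean prime ideal theorem: by Zorn's lemma there is a maximal proper ideal above \<open>I\<close>, and
  its complement is an ultrafilter.\<close>

lemma ideal_extends_to_ultrafilter:
  assumes I: "proper_ideal_on K I"
  obtains D where "ultrafilter_on K D" and "D \<inter> I = {}"
proof -
  let ?F = "{J. proper_ideal_on K J \<and> I \<subseteq> J}"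
  have "\<exists>M\<in>?F. \<forall>X\<in>?F. M \<subseteq> X \<longrightarrow> X = M"
  proof (rule subset_Zorn_nonempty)
    show "?F \<noteq> {}"
      using I by blast
  next
    fix C assume "C \<noteq> {}" and C: "subset.chain ?F C"
    have CF: "J \<in> ?F" if "J \<in> C" for J
      using C that by (auto simp: subset.chain_def)
    have tot: "J \<subseteq> J' \<or> J' \<subseteq> J" if "J \<in> C" "J' \<in> C" for J J'
      using C that by (auto simp: subset_chain_def)
    have "A \<union> B \<in> \<Union>C" if "A \<in> \<Union>C" "B \<in> \<Union>C" for A B
    proof -
      obtain J J' where J: "A \<in> J" "J \<in> C" "B \<in> J'" "J' \<in> C"
        using \<open>A \<in> \<Union>C\<close> \<open>B \<in> \<Union>C\<close> by blast
      then obtain M where "A \<in> M" "B \<in> M" "M \<in> C"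
        using tot[of J J'] by blast
      then show ?thesis
        using CF[of M] unfolding proper_ideal_on_def by blast
    qed
    moreover have "B \<in> \<Union>C" if "A \<in> \<Union>C" "B \<subseteq> A" for A B
      using that CF unfolding proper_ideal_on_def by blast
    moreover have "\<Union>C \<subseteq> Pow K" "K \<notin> \<Union>C"
      using CF unfolding proper_ideal_on_def by blast+
    moreover obtain J where "J \<in> C" "I \<subseteq> J"
      using CF \<open>C \<noteq> {}\<close> by blast
    then have "I \<subseteq> \<Union>C"
      by blast
    moreover have "{} \<in> \<Union>C"
      using proper_ideal_onD(2)[OF I] \<open>I \<subseteq> \<Union>C\<close> by (rule rev_subsetD)
    ultimately show "\<Union>C \<in> ?F"
      unfolding proper_ideal_on_def by blast
  qed
  then obtain M where M: "proper_ideal_on K M" "I \<subseteq> M"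
    and max: "\<And>X. proper_ideal_on K X \<Longrightarrow> M \<subseteq> X \<Longrightarrow> X = M"
    by auto
  have prime: "K - A \<in> M" if "A \<subseteq> K" "A \<notin> M" for A
  proof (rule ccontr)
    assume neg: "K - A \<notin> M"
    \<comment> \<open>The ideal generated by \<open>M\<close> and \<open>A\<close>, which is proper because \<open>K - A\<close> is not in \<open>M\<close>.\<close>
    let ?X = "{B \<in> Pow K. B - A \<in> M}"
    have "proper_ideal_on K ?X"
      unfolding proper_ideal_on_def
    proof (intro conjI ballI allI impI)
      fix B C assume "B \<in> ?X" "C \<subseteq> B"
      moreover from this have "C - A \<subseteq> B - A" by blast
      ultimately show "C \<in> ?X"
        using M(1) unfolding proper_ideal_on_def by blast
    next
      fix B C assume "B \<in> ?X" "C \<in> ?X"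
      then show "B \<union> C \<in> ?X"
        using M(1) by (simp add: proper_ideal_on_def Un_Diff)
    qed (use M(1) neg in \<open>auto simp: proper_ideal_on_def\<close>)
    moreover have "M \<subseteq> ?X"
    proof
      fix B assume "B \<in> M"
      then show "B \<in> ?X"
        using proper_ideal_onD(1,3)[OF M(1), of B] by (simp add: Diff_subset)
    qed
    ultimately have "?X = M" by (rule max)
    moreover have "A \<in> ?X"
      using that M(1) by (auto simp: proper_ideal_on_def)
    ultimately show False
      using that by simp
  qed
  let ?D = "Pow K - M"
  have "ultrafilter_on K ?D"
    unfolding ultrafilter_on_def
  proof (intro conjI ballI allI impI)
    fix A B assume AB: "A \<in> ?D" "B \<in> ?D"
    show "A \<inter> B \<in> ?D"
    proof (rule ccontr)
      assume "A \<inter> B \<notin> ?D"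
      then have "A \<inter> B \<in> M" "K - A \<in> M" "K - B \<in> M"
        using AB prime by auto
      then have "(A \<inter> B) \<union> ((K - A) \<union> (K - B)) \<in> M"
        using M(1) by (simp add: proper_ideal_on_def)
      moreover have "(A \<inter> B) \<union> ((K - A) \<union> (K - B)) = K"
        using AB by auto
      ultimately show False
        using M(1) by (simp add: proper_ideal_on_def)
    qed
  next
    fix A B assume "A \<in> ?D" "A \<subseteq> B \<and> B \<subseteq> K"
    then show "B \<in> ?D"
      using M(1) by (auto simp: proper_ideal_on_def)
  next
    fix A assume A: "A \<subseteq> K"
    show "A \<in> ?D \<or> K - A \<in> ?D"
    proof (rule ccontr)
      assume "\<not> ?thesis"
      then have "A \<union> (K - A) \<in> M"
        using A M(1) unfolding proper_ideal_on_def by blast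
      moreover have "A \<union> (K - A) = K" using A by auto
      ultimately show False
        using M(1) by (simp add: proper_ideal_on_def)
    qed
  qed (use M(1) in \<open>auto simp: proper_ideal_on_def\<close>)
  then show ?thesis
    using that[of ?D] M(2) by auto
qed

lemma ultrafilter_onD:
  assumes "ultrafilter_on K D"
  shows "A \<in> D \<Longrightarrow> B \<in> D \<Longrightarrow> A \<inter> B \<in> D"
    and "A \<in> D \<Longrightarrow> A \<subseteq> B \<Longrightarrow> B \<subseteq> K \<Longrightarrow> B \<in> D"
    and "A \<subseteq> K \<Longrightarrow> K - A \<in> D \<longleftrightarrow> A \<notin> D"
    and "A \<in> D \<Longrightarrow> A \<subseteq> K" and "K \<in> D"
proof -
  show "A \<subseteq> K \<Longrightarrow> K - A \<in> D \<longleftrightarrow> A \<notin> D"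
    using assms unfolding ultrafilter_on_def by (metis Diff_disjoint)
qed (use assms in \<open>auto simp: ultrafilter_on_def\<close>)

text \<open>A disjoint family of positive sets becomes a partition into positive sets, of the same
  cardinality, once one member has absorbed all uncovered points. The minimum defining
  \<^const>\<open>wsat\<close> is attained because a partition of \<open>K\<close> has at most \<open>|K|\<close> blocks, so that the
  cardinality of \<open>Pow K\<close> is a candidate.\<close>

lemma wsat_no_disjoint_family:
  assumes "K \<noteq> {}"
    and I: "proper_ideal_on K I"
  shows "Card_order (wsat K I)"
    and "\<nexists>E. E ` Field (wsat K I) \<subseteq> positive_sets K I \<and> disjoint_family_on E (Field (wsat K I))"
proof -
  let ?w = "wsat K I"
  let ?R = "{\<theta>::'a set rel. Card_order \<theta> \<and> Field \<theta> \<noteq> {} \<and>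
       \<not> (\<exists>Q. partition_on K Q \<and> Q \<subseteq> positive_sets K I \<and> |Q| =o \<theta>)}"
  have "|Q| \<le>o |K|" if Q: "partition_on K Q" for Q
  proof -
    have "Q \<subseteq> (\<lambda>x. THE q. q \<in> Q \<and> x \<in> q) ` K"
    proof
      fix q assume q: "q \<in> Q"
      with Q obtain x where x: "x \<in> q"
        by (metis all_not_in_conv partition_onD3)
      have "(THE q. q \<in> Q \<and> x \<in> q) = q"
        using q x partition_onD2[OF Q] by (auto intro!: the_equality simp: disjoint_def)
      moreover have "x \<in> K"
        using q x partition_onD1[OF Q] by auto
      ultimately show "q \<in> (\<lambda>x. THE q. q \<in> Q \<and> x \<in> q) ` K"
        by (intro image_eqI[of _ _ x]) auto
    qed
    then show ?thesis
      by (meson card_of_mono1 card_of_image ordLeq_transitive)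
  qed
  then have "|Q| <o |Pow K|" if "partition_on K Q" for Q
    using that card_of_Pow ordLeq_ordLess_trans by blast
  then have "\<not> (\<exists>Q. partition_on K Q \<and> Q \<subseteq> positive_sets K I \<and> |Q| =o |Pow K| )"
    using not_ordLess_ordIso by blast
  moreover have "Field |Pow K| \<noteq> {}"
    by (auto simp: Field_card_of)
  ultimately have "|Pow K| \<in> ?R"
    using card_of_Card_order[of "Pow K"] by blast
  then have R: "?w \<in> ?R"
    unfolding wsat_def by (intro min_card(1)) auto
  then show "Card_order ?w"
    by blast
  show "\<nexists>E. E ` Field ?w \<subseteq> positive_sets K I \<and> disjoint_family_on E (Field ?w)"
  proof clarify
    fix E assume E: "E ` Field ?w \<subseteq> positive_sets K I" and dis: "disjoint_family_on E (Field ?w)"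
    obtain a where a: "a \<in> Field ?w" using R by blast
    define rest where "rest = K - (\<Union>b\<in>Field ?w - {a}. E b)"
    define E' where "E' = E(a := rest)"
    have "E a \<subseteq> K"
      using E a unfolding positive_sets_def by blast
    moreover have "E a \<inter> E b = {}" if "b \<in> Field ?w - {a}" for b
      using disjoint_family_onD[OF dis a, of b] that by blast
    ultimately have "E a \<subseteq> rest"
      by (auto simp: rest_def)
    moreover have "rest \<subseteq> K" by (auto simp: rest_def)
    ultimately have "rest \<in> positive_sets K I"
      using E a proper_ideal_onD(3)[OF I, of rest "E a"] by (auto simp: positive_sets_def)
    then have E': "E' b \<in> positive_sets K I" if "b \<in> Field ?w" for b
      using E that by (auto simp: E'_def)
    then have ne: "E' b \<noteq> {}" if "b \<in> Field ?w" for b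
      using proper_ideal_onD(2)[OF I] that unfolding positive_sets_def by fastforce
    have dis': "disjoint_family_on E' (Field ?w)"
      using dis by (fastforce simp: disjoint_family_on_def E'_def rest_def)
    have "inj_on E' (Field ?w)"
      using dis' ne by (fastforce simp: inj_on_def disjoint_family_on_def)
    then have "|E' ` Field ?w| =o |Field ?w|"
      using card_of_ordIsoI[of E' "Field ?w"] inj_on_imp_bij_betw ordIso_symmetric by blast
    then have "|E' ` Field ?w| =o ?w"
      using R card_of_Field_ordIso ordIso_transitive by blast
    moreover have "partition_on K (E' ` Field ?w)"
    proof (rule partition_onI)
      have "E' b \<subseteq> K" if "b \<in> Field ?w" for b
        using E'[OF that] by (auto simp: positive_sets_def)
      then have "\<Union> (E' ` Field ?w) \<subseteq> K"
        by blast
      moreover have "K \<subseteq> E' a \<union> (\<Union>b\<in>Field ?w - {a}. E' b)"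
        by (auto simp: E'_def rest_def)
      ultimately show "\<Union> (E' ` Field ?w) = K"
        using a by blast
    next
      fix p q assume "p \<in> E' ` Field ?w" "q \<in> E' ` Field ?w" "p \<noteq> q"
      then show "disjnt p q"
        using disjoint_family_onD[OF dis'] unfolding disjnt_def by blast
    qed (use ne in auto)
    ultimately show False
      using R E' by blast
  qed
qed

section \<open>Products modulo an ultrafilter\<close>

abbreviation le_ult :: "'i set \<Rightarrow> ('i \<Rightarrow> 'a rel) \<Rightarrow> 'i set set \<Rightarrow> ('i \<Rightarrow> 'a) \<Rightarrow> ('i \<Rightarrow> 'a) \<Rightarrow> bool"
  where "le_ult K lam D \<equiv> le_mod K lam (dual_ideal K D)"

abbreviation ult_tcf :: "'i set \<Rightarrow> ('i \<Rightarrow> 'a rel) \<Rightarrow> 'i set set \<Rightarrow> ('i \<Rightarrow> 'a) rel"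
  where "ult_tcf K lam D \<equiv> tcf (card_prod K lam) (le_ult K lam D)"

lemma le_ult_iff:
  assumes "ultrafilter_on K D"
  shows "le_ult K lam D f g \<longleftrightarrow> {i \<in> K. (f i, g i) \<in> lam i} \<in> D"
proof -
  have "{i \<in> K. (f i, g i) \<notin> lam i} = K - {i \<in> K. (f i, g i) \<in> lam i}"
    by auto
  moreover have "K - A \<in> dual_ideal K D \<longleftrightarrow> A \<in> D" if "A \<subseteq> K" for A
    using ultrafilter_onD[OF assms] that
    by (auto simp: dual_ideal_def) (metis Diff_Diff_Int inf.absorb_iff2)
  ultimately show ?thesis
    by (auto simp: le_mod_def)
qed

lemma le_ultI:
  assumes "ultrafilter_on K D" and "\<And>i. i \<in> K \<Longrightarrow> (f i, g i) \<in> lam i"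
  shows "le_ult K lam D f g"
proof -
  have "{i \<in> K. (f i, g i) \<in> lam i} = K"
    using assms(2) by auto
  then show ?thesis
    using assms(1) by (simp add: le_ult_iff ultrafilter_onD(5))
qed

lemma le_ult_trans:
  assumes D: "ultrafilter_on K D" and lam: "\<And>i. i \<in> K \<Longrightarrow> Card_order (lam i)"
    and "le_ult K lam D f g" "le_ult K lam D g h"
  shows "le_ult K lam D f h"
proof -
  have "{i \<in> K. (f i, g i) \<in> lam i} \<inter> {i \<in> K. (g i, h i) \<in> lam i} \<in> D"
    using assms by (simp add: le_ult_iff ultrafilter_onD(1))
  then have "{i \<in> K. (f i, h i) \<in> lam i} \<in> D"
    by (rule ultrafilter_onD(2)[OF D]) (auto intro: Card_order_trans[OF lam])
  then show ?thesis
    by (simp add: le_ult_iff[OF D])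
qed

lemma le_ult_total:
  assumes D: "ultrafilter_on K D" and lam: "\<And>i. i \<in> K \<Longrightarrow> Card_order (lam i)"
    and "f \<in> card_prod K lam" "g \<in> card_prod K lam"
  shows "le_ult K lam D f g \<or> le_ult K lam D g f"
proof (rule ccontr)
  assume "\<not> ?thesis"
  then have "K - {i \<in> K. (f i, g i) \<in> lam i} \<in> D" "{i \<in> K. (g i, f i) \<in> lam i} \<notin> D"
    by (auto simp: le_ult_iff[OF D] ultrafilter_onD(3)[OF D])
  moreover have "K - {i \<in> K. (f i, g i) \<in> lam i} \<subseteq> {i \<in> K. (g i, f i) \<in> lam i}"
    using assms Card_order_total[OF lam] by (auto simp: card_prod_def PiE_iff) blast
  ultimately show False
    using ultrafilter_onD(2)[OF D] by (metis (no_types, lifting) mem_Collect_eq subsetI)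
qed

lemma le_mod_imp_le_ult:
  assumes D: "ultrafilter_on K D" "D \<inter> I = {}" and "le_mod K lam I f g"
  shows "le_ult K lam D f g"
proof -
  have "{i \<in> K. (f i, g i) \<notin> lam i} \<notin> D"
    using assms by (auto simp: le_mod_def)
  then have "K - {i \<in> K. (f i, g i) \<notin> lam i} \<in> D"
    by (simp add: ultrafilter_onD(3)[OF D(1)])
  moreover have "K - {i \<in> K. (f i, g i) \<notin> lam i} = {i \<in> K. (f i, g i) \<in> lam i}"
    by auto
  ultimately show ?thesis
    by (simp add: le_ult_iff[OF D(1)])
qed

lemma card_prod_max:
  assumes lam: "\<And>i. i \<in> K \<Longrightarrow> Card_order (lam i)"
    and fg: "f \<in> card_prod K lam" "g \<in> card_prod K lam"
  obtains h where "h \<in> card_prod K lam" "\<And>i. i \<in> K \<Longrightarrow> (f i, h i) \<in> lam i"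
    "\<And>i. i \<in> K \<Longrightarrow> (g i, h i) \<in> lam i"
proof
  let ?h = "\<lambda>i\<in>K. if (f i, g i) \<in> lam i then g i else f i"
  have F: "f i \<in> Field (lam i)" "g i \<in> Field (lam i)" if "i \<in> K" for i
    using fg that by (auto simp: card_prod_def)
  show "?h \<in> card_prod K lam"
    using F by (auto simp: card_prod_def)
  fix i assume i: "i \<in> K"
  show "(f i, ?h i) \<in> lam i" "(g i, ?h i) \<in> lam i"
    using i F[OF i] Card_order_total[OF lam[OF i], of "f i" "g i"] Card_order_refl[OF lam[OF i]]
    by auto
qed

lemma ult_no_maximum:
  assumes D: "ultrafilter_on K D" and lam: "\<And>i. i \<in> K \<Longrightarrow> Cinfinite (lam i)"
    and g: "g \<in> card_prod K lam"
  shows "\<exists>h\<in>card_prod K lam. \<not> le_ult K lam D h g"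
proof -
  have "\<forall>i\<in>K. \<exists>b\<in>Field (lam i). g i \<noteq> b \<and> (g i, b) \<in> lam i"
    using infinite_Card_order_limit[of "lam i" "g i" for i] lam g
    by (auto simp: cinfinite_def card_prod_def PiE_iff)
  then obtain h where h: "\<And>i. i \<in> K \<Longrightarrow> h i \<in> Field (lam i) \<and> g i \<noteq> h i \<and> (g i, h i) \<in> lam i"
    by metis
  then have "{i \<in> K. (restrict h K i, g i) \<in> lam i} = {}"
    using Card_order_antisym lam by fastforce
  then have "\<not> le_ult K lam D (restrict h K) g"
    using D by (simp add: le_ult_iff ultrafilter_on_def)
  moreover have "restrict h K \<in> card_prod K lam"
    using h by (auto simp: card_prod_def)
  ultimately show ?thesis by blast
qed

section \<open>True cofinality of total quasi-orders\<close>

text \<open>Enumerate a cofinal set \<open>C\<close> of least cardinality along that cardinal. At each stage the values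
  chosen before are fewer than \<open>|C|\<close>, so they are not cofinal, and by totality some element lies
  strictly above all of them. Joining it with the stage's element of \<open>C\<close> keeps the sequence
  cofinal.\<close>

lemma scale_from_cofinal_set:
  fixes P :: "'p set"
  assumes trans: "\<And>x y z. x \<in> P \<Longrightarrow> y \<in> P \<Longrightarrow> z \<in> P \<Longrightarrow> le x y \<Longrightarrow> le y z \<Longrightarrow> le x z"
    and total: "\<And>x y. x \<in> P \<Longrightarrow> y \<in> P \<Longrightarrow> le x y \<or> le y x"
    and A: "A \<subseteq> P" "\<And>q. q \<in> P \<Longrightarrow> \<exists>a\<in>A. le q a"
  shows "\<exists>\<nu>::'p rel. Card_order \<nu> \<and> has_scale P le \<nu> \<and> \<nu> \<le>o |A|"
proof -
  let ?cof = "{C. C \<subseteq> P \<and> (\<forall>q\<in>P. \<exists>a\<in>C. le q a)}"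
  have "\<exists>r\<in>card_of ` ?cof. \<forall>s\<in>card_of ` ?cof. r \<le>o s"
    using A by (intro exists_minim_Card_order) (auto intro: card_of_Card_order)
  then obtain C where C: "C \<subseteq> P" "\<And>q. q \<in> P \<Longrightarrow> \<exists>a\<in>C. le q a"
    and min: "\<And>B. B \<in> ?cof \<Longrightarrow> |C| \<le>o |B|"
    by auto
  have co: "Card_order |C|" by (rule card_of_Card_order)
  have refl: "le x x" if "x \<in> P" for x
    using total that by blast
  have "\<exists>p. \<forall>a\<in>Field |C|. p a \<in> {y \<in> P. le a y} \<and>
      (\<forall>b\<in>underS |C| a. le (p b) (p a) \<and> \<not> le (p a) (p b))"
  proof (rule transfinite_choice)
    show "Well_order |C|" by (rule card_of_Well_order)
  next
    fix a and p :: "'p \<Rightarrow> 'p"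
    assume a: "a \<in> Field |C|" and p: "\<And>b. b \<in> underS |C| a \<Longrightarrow> p b \<in> {y \<in> P. le b y}"
    have aP: "a \<in> P" using a C(1) by (auto simp: Field_card_of)
    let ?S = "p ` underS |C| a"
    have "?S \<subseteq> P" using p by auto
    have "|?S| <o |C|"
      using card_of_image card_of_underS[OF co a] ordLeq_ordLess_trans by blast
    then have "?S \<notin> ?cof"
      using min not_ordLess_ordLeq by blast
    then obtain q where q: "q \<in> P" "\<And>s. s \<in> ?S \<Longrightarrow> \<not> le q s"
      using \<open>?S \<subseteq> P\<close> by auto
    obtain u where u: "u \<in> P" "le q u" "le a u"
      using total[OF q(1) aP] refl q(1) aP by blast
    have "le s u \<and> \<not> le u s" if "s \<in> ?S" for s
      using that q u total \<open>?S \<subseteq> P\<close> trans by (meson subsetD)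
    then show "\<exists>y\<in>{y \<in> P. le a y}. \<forall>b\<in>underS |C| a. le (p b) y \<and> \<not> le y (p b)"
      using u by blast
  qed
  then obtain p where p: "\<And>a. a \<in> Field |C| \<Longrightarrow> p a \<in> {y \<in> P. le a y}"
    and mono: "\<And>a b. a \<in> Field |C| \<Longrightarrow> b \<in> underS |C| a \<Longrightarrow> le (p b) (p a) \<and> \<not> le (p a) (p b)"
    by blast
  have "has_scale P le |C|"
    unfolding has_scale_def
  proof (intro exI conjI ballI allI impI)
    fix a b assume ab: "(a, b) \<in> |C| \<and> a \<noteq> b"
    then have "b \<in> Field |C|" "a \<in> underS |C| b"
      by (auto simp: underS_def Field_def)
    then show "le (p a) (p b)" "\<not> le (p b) (p a)"
      using mono by blast+
  next
    fix q assume "q \<in> P"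
    then obtain a where "a \<in> C" "le q a" using C(2) by blast
    then show "\<exists>a\<in>Field |C|. le q (p a)"
      using p[of a] trans[of q a "p a"] \<open>q \<in> P\<close> C(1)
      by (auto simp: Field_card_of intro!: bexI[of _ a])
  qed (use p in auto)
  moreover have "|C| \<le>o |A|"
    using A by (intro min) auto
  ultimately show ?thesis
    using co by blast
qed

text \<open>The cofinality of a total quasi-order: if a set smaller than the true cofinality were unbounded,
  it would be cofinal and carry a shorter scale.\<close>

lemma tcf_total_quasi_order:
  fixes P :: "'p set"
  assumes trans: "\<And>x y z. x \<in> P \<Longrightarrow> y \<in> P \<Longrightarrow> z \<in> P \<Longrightarrow> le x y \<Longrightarrow> le y z \<Longrightarrow> le x z"
    and total: "\<And>x y. x \<in> P \<Longrightarrow> y \<in> P \<Longrightarrow> le x y \<or> le y x"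
  shows "Card_order (tcf P le)"
    and "\<exists>C\<subseteq>P. |C| \<le>o tcf P le \<and> (\<forall>q\<in>P. \<exists>c\<in>C. le q c)"
    and "\<And>A. A \<subseteq> P \<Longrightarrow> |A| <o tcf P le \<Longrightarrow> \<exists>u\<in>P. \<forall>a\<in>A. le a u"
proof -
  let ?R = "{\<mu>::'p rel. Card_order \<mu> \<and> has_scale P le \<mu>}"
  have refl: "le x x" if "x \<in> P" for x
    using total that by blast
  have "\<exists>\<nu>::'p rel. Card_order \<nu> \<and> has_scale P le \<nu> \<and> \<nu> \<le>o |P|"
    by (rule scale_from_cofinal_set[OF trans total]) (use refl in auto)
  then have "?R \<noteq> {}"
    by blast
  note min = min_card[OF this, folded tcf_def]
  have t: "Card_order (tcf P le)" "has_scale P le (tcf P le)"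
    using min(1) by auto
  show "Card_order (tcf P le)" by (fact t)
  obtain p where p: "\<forall>a\<in>Field (tcf P le). p a \<in> P" "\<forall>q\<in>P. \<exists>a\<in>Field (tcf P le). le q (p a)"
    using t(2) unfolding has_scale_def by blast
  have "|p ` Field (tcf P le)| \<le>o tcf P le"
    using card_of_image card_of_Field_ordIso[OF t(1)] ordLeq_ordIso_trans by blast
  then show "\<exists>C\<subseteq>P. |C| \<le>o tcf P le \<and> (\<forall>q\<in>P. \<exists>c\<in>C. le q c)"
    using p by (intro exI[of _ "p ` Field (tcf P le)"]) auto
  fix A assume A: "A \<subseteq> P" "|A| <o tcf P le"
  show "\<exists>u\<in>P. \<forall>a\<in>A. le a u"
  proof (rule ccontr)
    assume neg: "\<not> ?thesis"
    have "\<exists>a\<in>A. le q a" if "q \<in> P" for q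
      using neg that total A(1) by (meson subsetD)
    then have "\<exists>\<nu>::'p rel. Card_order \<nu> \<and> has_scale P le \<nu> \<and> \<nu> \<le>o |A|"
      by (intro scale_from_cofinal_set[OF trans total A(1)])
    then obtain \<nu> where "\<nu> \<in> ?R" "\<nu> \<le>o |A|"
      by blast
    then show False
      using min(2) A(2) by (metis (no_types, lifting) mem_Collect_eq not_ordLess_ordLeq ordLeq_transitive)
  qed
qed

lemma ult_tcf:
  assumes D: "ultrafilter_on K D" and lam: "\<And>i. i \<in> K \<Longrightarrow> Card_order (lam i)"
  shows "Card_order (ult_tcf K lam D)"
    and "\<exists>C\<subseteq>card_prod K lam. |C| \<le>o ult_tcf K lam D \<and> (\<forall>q\<in>card_prod K lam. \<exists>c\<in>C. le_ult K lam D q c)"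
    and "\<And>A. A \<subseteq> card_prod K lam \<Longrightarrow> |A| <o ult_tcf K lam D \<Longrightarrow>
      \<exists>u\<in>card_prod K lam. \<forall>a\<in>A. le_ult K lam D a u"
proof -
  note tcf = tcf_total_quasi_order[of "card_prod K lam" "le_ult K lam D",
      OF le_ult_trans[OF D lam] le_ult_total[OF D lam]]
  show "Card_order (ult_tcf K lam D)"
    by (rule tcf(1))
  show "\<exists>C\<subseteq>card_prod K lam. |C| \<le>o ult_tcf K lam D \<and> (\<forall>q\<in>card_prod K lam. \<exists>c\<in>C. le_ult K lam D q c)"
    by (rule tcf(2))
  show "\<exists>u\<in>card_prod K lam. \<forall>a\<in>A. le_ult K lam D a u"
    if "A \<subseteq> card_prod K lam" "|A| <o ult_tcf K lam D" for A
    using that by (rule tcf(3)[rotated -2])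
qed

section \<open>Simultaneous bounds\<close>

text \<open>Regularity of each coordinate allows a pointwise upper bound wherever the coordinate exceeds the
  number of functions. Elsewhere the bound takes the values of an arbitrary member \<open>z\<close> of the
  product.\<close>

lemma card_prod_dominate_few:
  assumes lam: "\<And>i. i \<in> K \<Longrightarrow> Card_order (lam i) \<and> regularCard (lam i)"
    and H: "\<And>b. b \<in> S \<Longrightarrow> H b \<in> card_prod K lam"
    and z: "z \<in> card_prod K lam"
  obtains g where "g \<in> card_prod K lam"
    and "\<And>b i. i \<in> K \<Longrightarrow> |S| <o lam i \<Longrightarrow> b \<in> S \<Longrightarrow> (H b i, g i) \<in> lam i"
proof -
  have "\<exists>y\<in>Field (lam i). \<forall>b\<in>S. (H b i, y) \<in> lam i" if i: "i \<in> K" "|S| <o lam i" for i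
  proof -
    have "|(\<lambda>b. H b i) ` S| <o lam i"
      using i(2) card_of_image ordLeq_ordLess_trans by blast
    moreover have "(\<lambda>b. H b i) ` S \<subseteq> Field (lam i)"
      using H i(1) by (auto simp: card_prod_def PiE_iff)
    ultimately show ?thesis
      using regularCard_bounded[of "lam i" "(\<lambda>b. H b i) ` S"] lam[OF i(1)] by auto
  qed
  then obtain y where y: "\<And>i. i \<in> K \<Longrightarrow> |S| <o lam i \<Longrightarrow>
      y i \<in> Field (lam i) \<and> (\<forall>b\<in>S. (H b i, y i) \<in> lam i)"
    by metis
  show ?thesis
  proof
    show "(\<lambda>i\<in>K. if |S| <o lam i then y i else z i) \<in> card_prod K lam"
      using y z by (auto simp: card_prod_def PiE_iff)
  qed (use y in auto)
qed

text \<open>If smaller families have simultaneous bounds, then \<open>F\<close> is dominated by a family that increases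
  along a well-ordering of \<open>F\<close> in type \<open>|F|\<close>: each new member is a bound of the earlier ones,
  joined with the corresponding element of \<open>F\<close>.\<close>

lemma increasing_domination:
  fixes F :: "('i \<Rightarrow> 'a) set"
  assumes lam: "\<And>i. i \<in> K \<Longrightarrow> Card_order (lam i)"
    and U: "\<And>D. D \<in> U \<Longrightarrow> ultrafilter_on K D"
    and F: "F \<subseteq> card_prod K lam"
    and small: "\<And>G. G \<subseteq> card_prod K lam \<Longrightarrow> |G| <o |F| \<Longrightarrow>
      \<exists>g\<in>card_prod K lam. \<forall>D\<in>U. \<forall>f\<in>G. le_ult K lam D f g"
  obtains p where "\<And>x. x \<in> F \<Longrightarrow> p x \<in> card_prod K lam"
    and "\<And>x D. x \<in> F \<Longrightarrow> D \<in> U \<Longrightarrow> le_ult K lam D x (p x)"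
    and "\<And>x y D. (x, y) \<in> |F| \<Longrightarrow> D \<in> U \<Longrightarrow> le_ult K lam D (p x) (p y)"
proof -
  have co: "Card_order |F|" by (rule card_of_Card_order)
  have "\<exists>p. \<forall>x\<in>Field |F|. p x \<in> {y \<in> card_prod K lam. \<forall>D\<in>U. le_ult K lam D x y} \<and>
      (\<forall>y\<in>underS |F| x. \<forall>D\<in>U. le_ult K lam D (p y) (p x))"
  proof (rule transfinite_choice)
    fix x and p :: "('i \<Rightarrow> 'a) \<Rightarrow> ('i \<Rightarrow> 'a)"
    assume x: "x \<in> Field |F|"
      and p: "\<And>b. b \<in> underS |F| x \<Longrightarrow> p b \<in> {y \<in> card_prod K lam. \<forall>D\<in>U. le_ult K lam D b y}"
    have "|p ` underS |F| x| <o |F|"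
      using card_of_image card_of_underS[OF co x] ordLeq_ordLess_trans by blast
    moreover have "p ` underS |F| x \<subseteq> card_prod K lam" using p by auto
    ultimately obtain g where g: "g \<in> card_prod K lam"
        "\<And>D b. D \<in> U \<Longrightarrow> b \<in> underS |F| x \<Longrightarrow> le_ult K lam D (p b) g"
      using small[of "p ` underS |F| x"] by auto
    have "x \<in> card_prod K lam" using x F by (auto simp: Field_card_of)
    then obtain h where h: "h \<in> card_prod K lam" "\<And>i. i \<in> K \<Longrightarrow> (g i, h i) \<in> lam i"
        "\<And>i. i \<in> K \<Longrightarrow> (x i, h i) \<in> lam i"
      using card_prod_max[OF lam g(1)] by blast
    have "le_ult K lam D x h" "le_ult K lam D g h" if "D \<in> U" for D
      using h U[OF that] by (auto intro: le_ultI)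
    moreover have "le_ult K lam D (p b) h" if "D \<in> U" "b \<in> underS |F| x" for D b
      using g(2)[OF that] \<open>\<And>D. D \<in> U \<Longrightarrow> le_ult K lam D g h\<close>[OF that(1)]
      by (intro le_ult_trans[of K D lam "p b" g h] U[OF that(1)] lam)
    ultimately show "\<exists>y\<in>{y \<in> card_prod K lam. \<forall>D\<in>U. le_ult K lam D x y}.
        \<forall>b\<in>underS |F| x. \<forall>D\<in>U. le_ult K lam D (p b) y"
      using h(1) by blast
  qed (rule card_of_Well_order)
  then obtain p where p: "\<And>x. x \<in> Field |F| \<Longrightarrow> p x \<in> {y \<in> card_prod K lam. \<forall>D\<in>U. le_ult K lam D x y}"
    and mono: "\<And>x y. x \<in> Field |F| \<Longrightarrow> y \<in> underS |F| x \<Longrightarrow> \<forall>D\<in>U. le_ult K lam D (p y) (p x)"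
    by blast
  show ?thesis
  proof (rule that)
    fix x y D assume xy: "(x, y) \<in> |F|" and D: "D \<in> U"
    show "le_ult K lam D (p x) (p y)"
    proof (cases "x = y")
      case True
      have "x \<in> F" using xy by (metis FieldI1 Field_card_of)
      then have "p x \<in> card_prod K lam" using p by (auto simp: Field_card_of)
      then show ?thesis
        using True le_ult_total[where lam=lam, OF U[OF D] lam] by blast
    next
      case False
      then show ?thesis
        using xy D mono[of y x] by (auto simp: underS_def Field_def)
    qed
  qed (use p in \<open>auto simp: Field_card_of\<close>)
qed

text \<open>Separate bounds modulo the ultrafilters in \<open>U\<close> yield a bound modulo all of them. The cardinal
  \<open>w\<close> bounds disjoint families of positive sets, \<open>few\<close> makes pointwise suprema of fewer than \<open>w\<close>
  functions available off a set in \<open>I\<close>, and \<open>dir\<close> bounds any \<open>w\<close> functions modulo \<open>I\<close>.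

  The increasing family \<open>p\<close> either has a cofinal part of size at most \<open>w\<close>, which \<open>dir\<close> bounds, or any
  \<open>w\<close> of its members lie below a single one. This dichotomy replaces a distinction between regular and
  singular sizes.\<close>

lemma uniform_bound:
  fixes F :: "('i \<Rightarrow> 'a) set" and w :: "'b rel"
  assumes lam: "\<And>i. i \<in> K \<Longrightarrow> Card_order (lam i) \<and> regularCard (lam i)"
    and U: "\<And>D. D \<in> U \<Longrightarrow> ultrafilter_on K D \<and> D \<inter> I = {}"
    and w: "Card_order w"
    and sat: "\<nexists>E. E ` Field w \<subseteq> positive_sets K I \<and> disjoint_family_on E (Field w)"
    and few: "\<And>a. a \<in> Field w \<Longrightarrow> {i \<in> K. \<not> |underS w a| <o lam i} \<in> I"
    and dir: "\<And>A. A \<subseteq> card_prod K lam \<Longrightarrow> |A| \<le>o w \<Longrightarrow>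
      \<exists>g\<in>card_prod K lam. \<forall>a\<in>A. le_mod K lam I a g"
    and F: "F \<subseteq> card_prod K lam"
    and bd: "\<And>D G. D \<in> U \<Longrightarrow> G \<subseteq> card_prod K lam \<Longrightarrow> |G| \<le>o |F| \<Longrightarrow>
      \<exists>g\<in>card_prod K lam. \<forall>f\<in>G. le_ult K lam D f g"
  shows "\<exists>g\<in>card_prod K lam. \<forall>D\<in>U. \<forall>f\<in>F. le_ult K lam D f g"
proof -
  have "F \<subseteq> card_prod K lam \<longrightarrow> (\<forall>D\<in>U. \<forall>G\<subseteq>card_prod K lam. |G| \<le>o |F| \<longrightarrow>
      (\<exists>g\<in>card_prod K lam. \<forall>f\<in>G. le_ult K lam D f g)) \<longrightarrow>
      (\<exists>g\<in>card_prod K lam. \<forall>D\<in>U. \<forall>f\<in>F. le_ult K lam D f g)"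
  proof (induction F rule: wf_induct_rule[OF wf_inv_image[OF wf_ordLess, of card_of]])
    case (1 F)
    show ?case
    proof (intro impI)
      assume F: "F \<subseteq> card_prod K lam"
        and bdF: "\<forall>D\<in>U. \<forall>G\<subseteq>card_prod K lam. |G| \<le>o |F| \<longrightarrow>
          (\<exists>g\<in>card_prod K lam. \<forall>f\<in>G. le_ult K lam D f g)"
      have lam': "\<And>i. i \<in> K \<Longrightarrow> Card_order (lam i)"
        using lam by blast
      have U': "\<And>D. D \<in> U \<Longrightarrow> ultrafilter_on K D"
        using U by blast
      have small: "\<exists>g\<in>card_prod K lam. \<forall>D\<in>U. \<forall>f\<in>G. le_ult K lam D f g"
        if "G \<subseteq> card_prod K lam" "|G| <o |F|" for G
      proof -
        have "|G'| \<le>o |F|" if "|G'| \<le>o |G|" for G' :: "('i \<Rightarrow> 'a) set"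
          using that \<open>|G| <o |F|\<close> ordLeq_ordLess_trans ordLess_imp_ordLeq by blast
        then show ?thesis
          using "1.IH"[of G] that bdF by (simp add: in_inv_image)
      qed
      obtain p where p: "\<And>x. x \<in> F \<Longrightarrow> p x \<in> card_prod K lam"
        and dom: "\<And>x D. x \<in> F \<Longrightarrow> D \<in> U \<Longrightarrow> le_ult K lam D x (p x)"
        and mono: "\<And>x y D. (x, y) \<in> |F| \<Longrightarrow> D \<in> U \<Longrightarrow> le_ult K lam D (p x) (p y)"
        using increasing_domination[OF lam' U' F small] by blast
      have trans: "le_ult K lam D f h" if "D \<in> U" "le_ult K lam D f g" "le_ult K lam D g h" for D f g h
        using that(2,3) by (intro le_ult_trans[of K D lam f g h] U'[OF that(1)] lam')
      have "\<exists>g\<in>card_prod K lam. \<forall>D\<in>U. \<forall>x\<in>F. le_ult K lam D (p x) g"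
      proof (cases "\<exists>X\<subseteq>F. |X| \<le>o w \<and> (\<forall>x\<in>F. \<exists>y\<in>X. (x, y) \<in> |F| )")
        case True
        then obtain X where X: "X \<subseteq> F" "|X| \<le>o w" "\<And>x. x \<in> F \<Longrightarrow> \<exists>y\<in>X. (x, y) \<in> |F|"
          by blast
        have "|p ` X| \<le>o w"
          using X(2) card_of_image ordLeq_transitive by blast
        moreover have "p ` X \<subseteq> card_prod K lam"
          using X(1) p by blast
        ultimately obtain g where g: "g \<in> card_prod K lam" "\<And>y. y \<in> X \<Longrightarrow> le_mod K lam I (p y) g"
          using dir[of "p ` X"] by auto
        have "le_ult K lam D (p x) g" if Dx: "D \<in> U" "x \<in> F" for D x
        proof -
          obtain y where "y \<in> X" "(x, y) \<in> |F|" using X(3) Dx(2) by blast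
          moreover have "le_ult K lam D (p y) g"
            using g(2) \<open>y \<in> X\<close> U[OF Dx(1)] by (blast intro: le_mod_imp_le_ult)
          ultimately show ?thesis
            using trans[OF Dx(1) mono[OF _ Dx(1)]] by blast
        qed
        then show ?thesis using g(1) by blast
      next
        case False
        have above: "\<exists>x\<in>F. \<forall>y\<in>X. (y, x) \<in> |F|" if X: "X \<subseteq> F" "|X| \<le>o w" for X
        proof -
          have "\<not> (\<forall>x\<in>F. \<exists>y\<in>X. (x, y) \<in> |F| )"
            using False X by simp
          then obtain x where x: "x \<in> F" "\<forall>y\<in>X. (x, y) \<notin> |F|"
            by auto
          have "(y, x) \<in> |F|" if "y \<in> X" for y
            using Card_order_total[OF card_of_Card_order[of F], of x y] x X(1) that
            by (auto simp: Field_card_of)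
          then show ?thesis using x(1) by blast
        qed
        show ?thesis
        proof (rule ccontr)
          assume neg: "\<not> ?thesis"
          have "\<exists>D x h. D \<in> U \<and> x \<in> F \<and> \<not> le_ult K lam D (p x) g \<and>
              h \<in> card_prod K lam \<and> (\<forall>y\<in>F. le_ult K lam D (p y) h)" if g: "g \<in> card_prod K lam" for g
          proof -
            obtain D x where D: "D \<in> U" "x \<in> F" "\<not> le_ult K lam D (p x) g"
              using neg g by blast
            have "p ` F \<subseteq> card_prod K lam" using p by auto
            then obtain h where "h \<in> card_prod K lam" "\<forall>y\<in>F. le_ult K lam D (p y) h"
              using bdF[rule_format, OF D(1) _ card_of_image[of p F]] by auto
            then show ?thesis using D by blast
          qed
          \<comment> \<open>\<open>g\<close> fails modulo \<open>D g\<close> at \<open>p (x g)\<close>, and \<open>H g\<close> bounds the whole family modulo \<open>D g\<close>.\<close>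
          then obtain D x H where
            D: "\<And>g. g \<in> card_prod K lam \<Longrightarrow> D g \<in> U" and
            x: "\<And>g. g \<in> card_prod K lam \<Longrightarrow> x g \<in> F \<and> \<not> le_ult K lam (D g) (p (x g)) g" and
            H: "\<And>g. g \<in> card_prod K lam \<Longrightarrow> H g \<in> card_prod K lam" and
            Hb: "\<And>g y. g \<in> card_prod K lam \<Longrightarrow> y \<in> F \<Longrightarrow> le_ult K lam (D g) (p y) (H g)"
            by metis
          obtain z where z: "z \<in> card_prod K lam"
            using dir[of "{}"] w by (auto simp: Card_order_empty)
          \<comment> \<open>The candidates dominate earlier corrections only at coordinates larger than the stage.
            Requiring this pointwise rather than modulo \<open>I\<close> makes the sets \<open>E a\<close> below disjoint.
            Domination modulo \<open>I\<close> would give intersections in \<open>I\<close> only, which cannot all be removed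
            unless \<open>I\<close> is sufficiently complete.\<close>
          have "\<exists>g. \<forall>a\<in>Field w. g a \<in> card_prod K lam \<and> (\<forall>b\<in>underS w a.
              \<forall>i\<in>K. |underS w a| <o lam i \<longrightarrow> (H (g b) i, g a i) \<in> lam i)"
          proof (rule transfinite_choice)
            show "Well_order w" using w by (rule card_order_on_well_order_on)
          next
            fix a g assume "\<And>b. b \<in> underS w a \<Longrightarrow> g b \<in> card_prod K lam"
            then have "\<And>b. b \<in> underS w a \<Longrightarrow> H (g b) \<in> card_prod K lam"
              using H by blast
            then obtain y where "y \<in> card_prod K lam"
              "\<And>b i. i \<in> K \<Longrightarrow> |underS w a| <o lam i \<Longrightarrow> b \<in> underS w a \<Longrightarrow> (H (g b) i, y i) \<in> lam i"
              using card_prod_dominate_few[of K lam "underS w a" "\<lambda>b. H (g b)" z] lam z by blast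
            then show "\<exists>y\<in>card_prod K lam. \<forall>b\<in>underS w a. \<forall>i\<in>K.
                |underS w a| <o lam i \<longrightarrow> (H (g b) i, y i) \<in> lam i"
              by blast
          qed
          then obtain g where g: "\<And>a. a \<in> Field w \<Longrightarrow> g a \<in> card_prod K lam"
            and gH: "\<And>a b. a \<in> Field w \<Longrightarrow> b \<in> underS w a \<Longrightarrow>
              \<forall>i\<in>K. |underS w a| <o lam i \<longrightarrow> (H (g b) i, g a i) \<in> lam i"
            by blast
          have "|(\<lambda>a. x (g a)) ` Field w| \<le>o w"
            using card_of_image card_of_Field_ordIso[OF w] ordLeq_ordIso_trans by blast
          moreover have "(\<lambda>a. x (g a)) ` Field w \<subseteq> F"
            using x g by blast
          ultimately obtain s where s: "s \<in> F" "\<And>a. a \<in> Field w \<Longrightarrow> (x (g a), s) \<in> |F|"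
            using above[of "(\<lambda>a. x (g a)) ` Field w"] by auto
          \<comment> \<open>On \<open>E a\<close> the fixed function \<open>p s\<close> is overtaken by \<open>H (g a)\<close>. It therefore lies below
            \<open>g b\<close>, for every later \<open>b\<close>, at those coordinates that exceed the stage \<open>b\<close>.\<close>
          define E where "E a = {i \<in> K. (p s i, g a i) \<notin> lam i} \<inter>
              {i \<in> K. (p s i, H (g a) i) \<in> lam i} \<inter> {i \<in> K. |underS w a| <o lam i}" for a
          have "E a \<in> positive_sets K I" if a: "a \<in> Field w" for a
          proof -
            let ?D = "D (g a)"
            have DU: "?D \<in> U" and uf: "ultrafilter_on K ?D" and disj: "?D \<inter> I = {}"
              using D g a U by blast+
            have "\<not> le_ult K lam ?D (p s) (g a)"
              using trans[OF DU mono[OF s(2)[OF a] DU]] x[OF g[OF a]] by blast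
            then have "K - {i \<in> K. (p s i, g a i) \<in> lam i} \<in> ?D"
              by (simp add: le_ult_iff[OF uf] ultrafilter_onD(3)[OF uf])
            then have 1: "{i \<in> K. (p s i, g a i) \<notin> lam i} \<in> ?D"
              by (rule ultrafilter_onD(2)[OF uf]) auto
            have 2: "{i \<in> K. (p s i, H (g a) i) \<in> lam i} \<in> ?D"
              using Hb[OF g[OF a] s(1)] by (simp add: le_ult_iff[OF uf])
            have "{i \<in> K. \<not> |underS w a| <o lam i} \<notin> ?D"
              using few[OF a] disj by blast
            then have "K - {i \<in> K. \<not> |underS w a| <o lam i} \<in> ?D"
              by (simp add: ultrafilter_onD(3)[OF uf])
            then have 3: "{i \<in> K. |underS w a| <o lam i} \<in> ?D"
              by (rule ultrafilter_onD(2)[OF uf]) auto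
            have "E a \<in> ?D"
              unfolding E_def by (intro ultrafilter_onD(1)[OF uf] 1 2 3)
            then show ?thesis
              using disj by (auto simp: positive_sets_def E_def)
          qed
          moreover have "disjoint_family_on E (Field w)"
          proof -
            have "E a \<inter> E b = {}" if "b \<in> Field w" "a \<in> underS w b" for a b
            proof (rule ccontr)
              assume "E a \<inter> E b \<noteq> {}"
              then obtain i where i: "i \<in> K" "(p s i, H (g a) i) \<in> lam i"
                "|underS w b| <o lam i" "(p s i, g b i) \<notin> lam i"
                by (auto simp: E_def)
              then show False
                using gH[OF that] Card_order_trans[OF lam'[OF i(1)]] by blast
            qed
            then show ?thesis
              using Card_order_underS_total[OF w] unfolding disjoint_family_on_def
              by (metis Int_commute)
          qed
          ultimately show False
            using sat by blast
        qed
      qed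
      then show "\<exists>g\<in>card_prod K lam. \<forall>D\<in>U. \<forall>f\<in>F. le_ult K lam D f g"
        using dom trans by blast
    qed
  qed
  then show ?thesis
    using F bd by blast
qed

section \<open>The maximum of pcf\<close>

text \<open>A cardinal below the limit inferior bounds only \<open>I\<close>-many coordinates. As the limit inferior is a
  cardinal on the coordinates' own type, a smaller \<open>X\<close> of any type has an equipotent copy there.\<close>

lemma liminf_mod_few:
  assumes I: "proper_ideal_on K I" and lam: "\<And>i. i \<in> K \<Longrightarrow> Card_order (lam i)"
    and X: "|X| <o liminf_mod K I lam"
  shows "{i \<in> K. \<not> |X| <o lam i} \<in> I"
proof (rule ccontr)
  assume neg: "\<not> ?thesis"
  let ?R = "{\<mu>::'b rel. Card_order \<mu> \<and> {i \<in> K. lam i \<le>o \<mu>} \<in> positive_sets K I}"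
  have "{i \<in> K. lam i \<le>o |UNIV :: 'b set| } = K"
    using lam card_of_Field_ordIso card_of_mono1[of _ UNIV]
    by (metis (mono_tags, lifting) Collect_cong Collect_mem_eq ordIso_ordLeq_trans ordIso_symmetric subset_UNIV)
  then have "|UNIV :: 'b set| \<in> ?R"
    using I card_of_Card_order[of "UNIV :: 'b set"] by (simp add: positive_sets_def proper_ideal_on_def)
  then have "?R \<noteq> {}" by blast
  note min = min_card(2)[OF this, folded liminf_mod_def]
  obtain B :: "'b set" where B: "|X| =o |B|"
    using ordLess_imp_ordLeq[OF X] internalize_card_of_ordLeq[of X "liminf_mod K I lam"] by blast
  have "{i \<in> K. lam i \<le>o |B| } = {i \<in> K. \<not> |X| <o lam i}"
  proof (intro Collect_cong conj_cong refl)
    fix i assume "i \<in> K"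
    then have "Well_order (lam i)" using lam card_order_on_well_order_on by blast
    then have "(\<not> |X| <o lam i) \<longleftrightarrow> lam i \<le>o |X|"
      by (rule not_ordLess_iff_ordLeq[OF _ card_of_Well_order])
    moreover have "lam i \<le>o |B| \<longleftrightarrow> lam i \<le>o |X|"
      using ordLeq_ordIso_trans[OF _ B] ordLeq_ordIso_trans[OF _ ordIso_symmetric[OF B]] by blast
    ultimately show "lam i \<le>o |B| \<longleftrightarrow> \<not> |X| <o lam i"
      by simp
  qed
  then have "|B| \<in> ?R"
    using neg card_of_Card_order[of B] by (auto simp: positive_sets_def)
  then have "liminf_mod K I lam \<le>o |B|"
    using min by blast
  moreover have "|B| <o liminf_mod K I lam"
    using B X ordIso_ordLess_trans ordIso_symmetric by blast
  ultimately show False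
    using not_ordLess_ordLeq by blast
qed

text \<open>If there were no maximum, an ultrafilter avoiding all sets \<open>A\<close> whose ultrafilters have bounded
  true cofinality would admit a family that is both cofinal and bounded.\<close>

lemma pcf_has_maximum:
  fixes lam :: "'i \<Rightarrow> 'a rel" and w :: "'b rel"
  assumes lam: "\<And>i. i \<in> K \<Longrightarrow> Cinfinite (lam i) \<and> regularCard (lam i)"
    and I: "proper_ideal_on K I"
    and w: "Card_order w"
    and sat: "\<nexists>E. E ` Field w \<subseteq> positive_sets K I \<and> disjoint_family_on E (Field w)"
    and few: "\<And>a. a \<in> Field w \<Longrightarrow> {i \<in> K. \<not> |underS w a| <o lam i} \<in> I"
    and dir: "\<And>A. A \<subseteq> card_prod K lam \<Longrightarrow> |A| \<le>o w \<Longrightarrow>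
      \<exists>g\<in>card_prod K lam. \<forall>a\<in>A. le_mod K lam I a g"
  shows "\<exists>\<mu>\<in>pcf K I lam. \<forall>\<nu>\<in>pcf K I lam. \<nu> \<le>o \<mu>"
proof (rule ccontr)
  assume no_max: "\<not> ?thesis"
  let ?U = "{D. ultrafilter_on K D \<and> D \<inter> I = {}}"
  let ?t = "ult_tcf K lam"
  have lam': "\<And>i. i \<in> K \<Longrightarrow> Card_order (lam i)" "\<And>i. i \<in> K \<Longrightarrow> Card_order (lam i) \<and> regularCard (lam i)"
      "\<And>i. i \<in> K \<Longrightarrow> Cinfinite (lam i)"
    using lam by blast+
  have pcf: "pcf K I lam = ?t ` ?U"
    by (auto simp: pcf_def)
  have wo: "Well_order (?t D)" if "D \<in> ?U" for D
    using ult_tcf(1)[of K D lam, OF _ lam'(1)] that card_order_on_well_order_on by blast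
  have not_less: "\<not> ?t D <o ?t D' \<longleftrightarrow> ?t D' \<le>o ?t D" if "D \<in> ?U" "D' \<in> ?U" for D D'
    using not_ordLess_iff_ordLeq wo that by blast
  have larger: "\<exists>D'\<in>?U. ?t D <o ?t D'" if "D \<in> ?U" for D
    using no_max that not_less unfolding pcf by blast
  \<comment> \<open>The union of the ideals \<open>J_{<\<mu>}\<close> over \<open>\<mu>\<close> in pcf.\<close>
  define J where "J = {A. A \<subseteq> K \<and> (\<exists>D0\<in>?U. \<forall>D\<in>?U. A \<in> D \<longrightarrow> ?t D <o ?t D0)}"
  have JI: "A \<in> J" if "A \<subseteq> K" "D0 \<in> ?U" "\<And>D. D \<in> ?U \<Longrightarrow> A \<in> D \<Longrightarrow> ?t D <o ?t D0" for A D0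
    using that unfolding J_def by blast
  have JE: "\<exists>D0\<in>?U. \<forall>D\<in>?U. A \<in> D \<longrightarrow> ?t D <o ?t D0" if "A \<in> J" for A
    using that unfolding J_def by blast
  obtain D1 where D1: "D1 \<in> ?U"
    using ideal_extends_to_ultrafilter[OF I] by blast
  have "proper_ideal_on K J"
    unfolding proper_ideal_on_def
  proof (intro conjI ballI allI impI)
    show "J \<subseteq> Pow K" by (auto simp: J_def)
    show "{} \<in> J"
      using D1 by (intro JI[of _ D1]) (auto simp: ultrafilter_on_def)
    show "K \<notin> J"
    proof
      assume "K \<in> J"
      then obtain D0 where D0: "D0 \<in> ?U" "\<forall>D\<in>?U. K \<in> D \<longrightarrow> ?t D <o ?t D0"
        using JE by blast
      then have "?t D0 <o ?t D0"
        using ultrafilter_onD(5)[of K D0] by blast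
      then show False
        by (simp add: ordLess_irreflexive)
    qed
  next
    fix A B assume A: "A \<in> J" and "B \<subseteq> A"
    obtain D0 where D0: "D0 \<in> ?U" "\<forall>D\<in>?U. A \<in> D \<longrightarrow> ?t D <o ?t D0"
      using JE[OF A] by blast
    have AK: "A \<subseteq> K" using A by (simp add: J_def)
    show "B \<in> J"
    proof (rule JI[of _ D0])
      fix D assume D: "D \<in> ?U" "B \<in> D"
      then have "A \<in> D"
        using ultrafilter_onD(2)[of K D B A] \<open>B \<subseteq> A\<close> AK by blast
      then show "?t D <o ?t D0" using D D0 by blast
    qed (use D0 AK \<open>B \<subseteq> A\<close> in auto)
  next
    fix A B assume A: "A \<in> J" and B: "B \<in> J"
    obtain D0 where D0: "D0 \<in> ?U" "\<forall>D\<in>?U. A \<in> D \<longrightarrow> ?t D <o ?t D0"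
      using JE[OF A] by blast
    obtain D1 where D1: "D1 \<in> ?U" "\<forall>D\<in>?U. B \<in> D \<longrightarrow> ?t D <o ?t D1"
      using JE[OF B] by blast
    have "\<exists>D2\<in>?U. ?t D0 \<le>o ?t D2 \<and> ?t D1 \<le>o ?t D2"
    proof (cases "?t D0 <o ?t D1")
      case True
      then show ?thesis
        using ordLess_imp_ordLeq ordLeq_reflexive[OF wo[OF D1(1)]] D1(1) by blast
    next
      case False
      then show ?thesis
        using not_less[OF D0(1) D1(1)] ordLeq_reflexive[OF wo[OF D0(1)]] D0(1) by blast
    qed
    then obtain D2 where D2: "D2 \<in> ?U" "?t D0 \<le>o ?t D2" "?t D1 \<le>o ?t D2"
      by blast
    have AB: "A \<subseteq> K" "B \<subseteq> K" using A B by (simp_all add: J_def)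
    show "A \<union> B \<in> J"
    proof (rule JI[of _ D2])
      fix D assume D: "D \<in> ?U" "A \<union> B \<in> D"
      then have uf: "ultrafilter_on K D" by blast
      have "A \<in> D \<or> B \<in> D"
      proof (rule ccontr)
        assume "\<not> ?thesis"
        then have "K - A \<in> D" "K - B \<in> D"
          using AB by (simp_all add: ultrafilter_onD(3)[OF uf])
        then have "(K - A) \<inter> (K - B) \<in> D"
          by (rule ultrafilter_onD(1)[OF uf])
        moreover have "(K - A) \<inter> (K - B) = K - (A \<union> B)" by blast
        ultimately show False
          using D(2) AB ultrafilter_onD(3)[OF uf, of "A \<union> B"] by simp
      qed
      then show "?t D <o ?t D2"
        using D(1) D0(2) D1(2) D2 ordLess_ordLeq_trans by blast
    qed (use D2 AB in auto)
  qed
  then obtain D where D: "ultrafilter_on K D" "D \<inter> J = {}"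
    using ideal_extends_to_ultrafilter by blast
  have "I \<subseteq> J"
  proof
    fix A assume "A \<in> I"
    then show "A \<in> J"
      using D1 I by (intro JI[of _ D1]) (auto simp: proper_ideal_on_def)
  qed
  then have DU: "D \<in> ?U" using D by blast
  then obtain D' where D': "D' \<in> ?U" "?t D <o ?t D'"
    using larger by blast
  let ?U' = "{E \<in> ?U. ?t D' \<le>o ?t E}"
  obtain C where C: "C \<subseteq> card_prod K lam" "|C| \<le>o ?t D"
      "\<And>q. q \<in> card_prod K lam \<Longrightarrow> \<exists>c\<in>C. le_ult K lam D q c"
    using ult_tcf(2)[where lam=lam, OF D(1) lam'(1)] by blast
  have "\<exists>g\<in>card_prod K lam. \<forall>E\<in>?U'. \<forall>f\<in>C. le_ult K lam E f g"
  proof (rule uniform_bound[where lam=lam, OF lam'(2) _ w sat few dir C(1)])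
    fix E G assume E: "E \<in> ?U'" and G: "G \<subseteq> card_prod K lam" "|G| \<le>o |C|"
    have "|G| \<le>o ?t D" using G(2) C(2) by (rule ordLeq_transitive)
    then have "|G| <o ?t D'" using D'(2) by (rule ordLeq_ordLess_trans)
    then have "|G| <o ?t E" using E ordLess_ordLeq_trans by blast
    then show "\<exists>g\<in>card_prod K lam. \<forall>f\<in>G. le_ult K lam E f g"
      using ult_tcf(3)[of K E lam, OF _ lam'(1) G(1)] E by blast
  qed auto
  then obtain g where g: "g \<in> card_prod K lam" "\<And>E f. E \<in> ?U' \<Longrightarrow> f \<in> C \<Longrightarrow> le_ult K lam E f g"
    by blast
  have Cg: "le_ult K lam D f g" if f: "f \<in> C" for f
  proof -
    let ?B = "{i \<in> K. (f i, g i) \<in> lam i}"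
    \<comment> \<open>An ultrafilter at which \<open>g\<close> is not above \<open>f\<close> has a true cofinality below that of \<open>D'\<close>.\<close>
    have "K - ?B \<in> J"
    proof (rule JI[OF _ D'(1)])
      fix E assume E: "E \<in> ?U" "K - ?B \<in> E"
      then have "?B \<notin> E"
        using ultrafilter_onD(3)[of K E ?B] by blast
      then have "E \<notin> ?U'"
        using g(2)[OF _ f] le_ult_iff[of K E lam f g] by blast
      then show "?t E <o ?t D'"
        using E not_less[OF E(1) D'(1)] by blast
    qed auto
    then have "K - ?B \<notin> D" using D(2) by blast
    then have "?B \<in> D" using ultrafilter_onD(3)[OF D(1), of ?B] by blast
    then show ?thesis by (simp add: le_ult_iff[OF D(1)])
  qed
  have "le_ult K lam D q g" if "q \<in> card_prod K lam" for q
    using C(3)[OF that] Cg le_ult_trans[where lam=lam, OF D(1) lam'(1)] by blast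
  then show False
    using ult_no_maximum[where lam=lam, OF D(1) lam'(3) g(1)] by blast
qed

theorem mainTheorem5:
  fixes \<kappa> :: "'i rel" and lam :: "'i \<Rightarrow> 'a rel" and I :: "'i set set" and \<theta> :: "'c rel"
  assumes "Cinfinite \<kappa>"
    and "\<And>i. i \<in> Field \<kappa> \<Longrightarrow> Cinfinite (lam i) \<and> regularCard (lam i)"
    and "proper_ideal_on (Field \<kappa>) I"
    and "Card_order \<theta>"
    and "(\<theta> <o min_card (lam ` Field \<kappa>) \<and> wsat (Field \<kappa>) I \<le>o \<theta>) \<or>
         (\<theta> \<le>o liminf_mod (Field \<kappa>) I lam \<and> wsat (Field \<kappa>) I \<le>o \<theta> \<and>
          directed (cardSuc \<theta>) (card_prod (Field \<kappa>) lam) (le_mod (Field \<kappa>) lam I))"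
  shows "\<exists>\<mu>\<in>pcf (Field \<kappa>) I lam. \<forall>\<nu>\<in>pcf (Field \<kappa>) I lam. \<nu> \<le>o \<mu>"
proof -
  let ?K = "Field \<kappa>"
  let ?w = "wsat ?K I"
  have K: "?K \<noteq> {}"
    using assms(1) by (auto simp: cinfinite_def)
  have lam: "\<And>i. i \<in> ?K \<Longrightarrow> Card_order (lam i) \<and> regularCard (lam i)"
    using assms(2) by blast
  note w = wsat_no_disjoint_family[OF K assms(3)]
  have le: "?w \<le>o \<theta>"
    using assms(5) by blast
  have small: "|underS ?w a| <o \<theta>" if "a \<in> Field ?w" for a
    using card_of_underS[OF w(1) that] le by (rule ordLess_ordLeq_trans)
  \<comment> \<open>In the first alternative the exceptional sets are empty, and the bounds are pointwise suprema.\<close>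
  have "(\<forall>a\<in>Field ?w. {i \<in> ?K. \<not> |underS ?w a| <o lam i} \<in> I) \<and>
      (\<forall>A\<subseteq>card_prod ?K lam. |A| \<le>o ?w \<longrightarrow> (\<exists>g\<in>card_prod ?K lam. \<forall>f\<in>A. le_mod ?K lam I f g))"
    using assms(5)
  proof (elim disjE conjE)
    assume "\<theta> <o min_card (lam ` ?K)"
    then have \<theta>: "\<theta> <o lam i" if "i \<in> ?K" for i
      using min_card(2)[of "lam ` ?K" "lam i"] lam that ordLess_ordLeq_trans by blast
    have "{i \<in> ?K. \<not> |underS ?w a| <o lam i} = {}" if "a \<in> Field ?w" for a
      using small[OF that] \<theta> ordLess_transitive by blast
    moreover have "\<exists>g\<in>card_prod ?K lam. \<forall>f\<in>A. le_mod ?K lam I f g"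
      if A: "A \<subseteq> card_prod ?K lam" "|A| \<le>o ?w" for A
    proof -
      have "|A| \<le>o \<theta>" using A(2) le by (rule ordLeq_transitive)
      then have few: "|A| <o lam i" if "i \<in> ?K" for i
        using \<theta>[OF that] by (rule ordLeq_ordLess_trans)
      have "Field (lam i) \<noteq> {}" if "i \<in> ?K" for i
        using assms(2)[OF that] by (auto simp: cinfinite_def)
      then obtain z where "z \<in> card_prod ?K lam"
        unfolding card_prod_def by (metis PiE_eq_empty_iff ex_in_conv)
      then obtain g where g: "g \<in> card_prod ?K lam"
          "\<And>f i. i \<in> ?K \<Longrightarrow> |A| <o lam i \<Longrightarrow> f \<in> A \<Longrightarrow> (f i, g i) \<in> lam i"
        using card_prod_dominate_few[of ?K lam A "\<lambda>f. f" z] lam A(1) by blast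
      have "le_mod ?K lam I f g" if "f \<in> A" for f
      proof -
        have "{i \<in> ?K. (f i, g i) \<notin> lam i} = {}"
          using g(2) few that by blast
        then show ?thesis
          using proper_ideal_onD(2)[OF assms(3)] unfolding le_mod_def by (rule ssubst)
      qed
      then show ?thesis
        using g(1) by blast
    qed
    ultimately show ?thesis
      using proper_ideal_onD(2)[OF assms(3)] by (metis (lifting))
  next
    assume liminf: "\<theta> \<le>o liminf_mod ?K I lam"
      and dir: "directed (cardSuc \<theta>) (card_prod ?K lam) (le_mod ?K lam I)"
    have "{i \<in> ?K. \<not> |underS ?w a| <o lam i} \<in> I" if "a \<in> Field ?w" for a
      using liminf_mod_few[OF assms(3)] lam small[OF that] liminf ordLess_ordLeq_trans by blast
    moreover have "|A| <o cardSuc \<theta>" if "|A| \<le>o ?w" for A :: "('i \<Rightarrow> 'a) set"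
      using ordLeq_transitive[OF that le] cardSuc_ordLeq_ordLess[OF assms(4) card_of_Card_order]
      by blast
    ultimately show ?thesis
      using dir unfolding directed_def by blast
  qed
  then show ?thesis
    by (intro pcf_has_maximum[OF assms(2,3) w]) blast+
qed

end
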